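(* Let $L$ be a number field of degree $n$ with a Hopf-Galois structure $H$, let $\mathcal{O}$ be a $\mathbb{Z}$-order in $L$, let $W=\{w_i\}_{i=1}^n$ be a $\mathbb{Q}$-basis of $H$ and let $B=\{\gamma_j\}_{j=1}^n$ be a $\mathbb{Z}$-basis of $\mathcal{O}$. An element $\beta=\sum_{j=1}^n\beta_j\gamma_j\in\mathcal{O}$ (with $\beta_j\in\mathbb{Z}$) is a free generator of $\mathcal{O}$ as an $\mathfrak{A}_H(\mathcal{O})$-module if and only if $$|\det(M_\beta(H_W,L_B))|=I_W(\mathcal{O}).$$
   Context: A Hopf-Galois structure on a number field $L$ is a finite-dimensional cocommutative $\mathbb{Q}$-Hopf algebra $H$ with a $\mathbb{Q}$-linear action $\cdot\colon H\otimes_{\mathbb{Q}}L\to L$ making $L$ an $H$-module algebra and such that $L\otimes_{\mathbb{Q}}H\to\mathrm{End}_{\mathbb{Q}}(L)$, $x\otimes h\mapsto (y\mapsto x(h\cdot y))$, is a $\mathbb{Q}$-linear isomorphism. A $\mathbb{Z}$-order in $L$ is a unital subring that is finitely generated over $\mathbb{Z}$ and contains a $\mathbb{Q}$-basis of $L$. The associated order is $\mathfrak{A}_H(\mathcal{O})=\{h\in H\mid h\cdot\mathcal{O}\subseteq\mathcal{O}\}$. For $1\le j\le n$, $M_j(H_W,L_B)\in\mathcal{M}_n(\mathbb{Q})$ is the matrix whose $i$-th column is the coordinate vector of $w_i\cdot\gamma_j$ with respect to $B$, and for $\beta=\sum_j\beta_j\gamma_j$, $M_\beta(H_W,L_B)=\sum_{j=1}^n\beta_jM_j(H_W,L_B)$.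 The matrix $M(H_W,L_B)\in\mathcal{M}_{n^2\times n}(\mathbb{Q})$ is obtained by stacking $M_1(H_W,L_B),\dots,M_n(H_W,L_B)$ vertically in this order. A reduced matrix of $M(H_W,L_B)$ is any $D\in\mathcal{M}_n(\mathbb{Q})$ for which there is $U\in\mathrm{GL}_{n^2}(\mathbb{Z})$ with $U M(H_W,L_B)=\begin{pmatrix}D\\ O\end{pmatrix}$, $O$ being the zero $(n^2-n)\times n$ matrix. Reduced matrices exist and are invertible over $\mathbb{Q}$; $I_W(\mathcal{O})=|\det(D)|$ for any reduced matrix $D$, and it equals the (generalized) module index $[\mathfrak{A}_H(\mathcal{O}):\langle W\rangle_{\mathbb{Z}}]$, so it is independent of $D$. *)

theory Defs
  imports
    "HOL-Library.Poly_Mapping"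
    "Jordan_Normal_Form.Determinant"
begin

section \<open>Rational vector spaces, rational algebras and number fields\<close>

class rat_vector = ab_group_add +
  fixes scaleQ :: "rat \<Rightarrow> 'a \<Rightarrow> 'a"  (infixr \<open>*\<^sub>Q\<close> 75)
  assumes scaleQ_add_right: "a *\<^sub>Q (x + y) = a *\<^sub>Q x + a *\<^sub>Q y"
    and scaleQ_add_left: "(a + b) *\<^sub>Q x = a *\<^sub>Q x + b *\<^sub>Q x"
    and scaleQ_scaleQ: "a *\<^sub>Q (b *\<^sub>Q x) = (a * b) *\<^sub>Q x"
    and scaleQ_one: "1 *\<^sub>Q x = x"

global_interpretation rat_vector: vector_space "scaleQ :: rat \<Rightarrow> 'a \<Rightarrow> 'a::rat_vector"
  defines rat_dependent = rat_vector.dependent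
    and rat_span = rat_vector.span
    and rat_representation = rat_vector.representation
    and rat_dim = rat_vector.dim
  by unfold_locales (fact scaleQ_add_right scaleQ_add_left scaleQ_scaleQ scaleQ_one)+

abbreviation rat_linear :: "('a::rat_vector \<Rightarrow> 'b::rat_vector) \<Rightarrow> bool" where
  "rat_linear \<equiv> Vector_Spaces.linear scaleQ scaleQ"

definition rat_bilinear :: "('a::rat_vector \<Rightarrow> 'b::rat_vector \<Rightarrow> 'c::rat_vector) \<Rightarrow> bool" where
  "rat_bilinear f \<longleftrightarrow> (\<forall>y. rat_linear (\<lambda>x. f x y)) \<and> (\<forall>x. rat_linear (f x))"

class rat_algebra_1 = rat_vector + ring_1 +
  assumes mult_scaleQ_left: "(a *\<^sub>Q x) * y = a *\<^sub>Q (x * y)"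
    and mult_scaleQ_right: "x * (a *\<^sub>Q y) = a *\<^sub>Q (x * y)"

class number_field = rat_algebra_1 + field +
  assumes finite_degree: "\<exists>S. finite S \<and> (\<forall>x. \<exists>c. x = (\<Sum>s\<in>S. c s *\<^sub>Q s))"


section \<open>The tensor product over the rationals\<close>

text \<open>The quotient of the free vector space on \<open>V \<times> W\<close> by the bilinearity relations. The
  coefficient \<open>c\<close> in the generators makes the generated additive subgroup a subspace.\<close>

inductive_set tensor_rel :: "(('a::rat_vector \<times> 'b::rat_vector) \<Rightarrow>\<^sub>0 rat) set" where
  zero: "0 \<in> tensor_rel"
| add: "u \<in> tensor_rel \<Longrightarrow> v \<in> tensor_rel \<Longrightarrow> u + v \<in> tensor_rel"
| add_left: "Poly_Mapping.single (x + x', y) c - Poly_Mapping.single (x, y) c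
    - Poly_Mapping.single (x', y) c \<in> tensor_rel"
| add_right: "Poly_Mapping.single (x, y + y') c - Poly_Mapping.single (x, y) c
    - Poly_Mapping.single (x, y') c \<in> tensor_rel"
| scale_left: "Poly_Mapping.single (q *\<^sub>Q x, y) c - Poly_Mapping.single (x, y) (q * c) \<in> tensor_rel"
| scale_right: "Poly_Mapping.single (x, q *\<^sub>Q y) c - Poly_Mapping.single (x, y) (q * c) \<in> tensor_rel"

definition tensor_eq ::
  "(('a::rat_vector \<times> 'b::rat_vector) \<Rightarrow>\<^sub>0 rat) \<Rightarrow> (('a \<times> 'b) \<Rightarrow>\<^sub>0 rat) \<Rightarrow> bool" where
  "tensor_eq u v \<longleftrightarrow> u - v \<in> tensor_rel"

abbreviation free_scale :: "rat \<Rightarrow> ('a \<Rightarrow>\<^sub>0 rat) \<Rightarrow> ('a \<Rightarrow>\<^sub>0 rat)" where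
  "free_scale q \<equiv> Poly_Mapping.map ((*) q)"

lemma lookup_free_scale: "Poly_Mapping.lookup (free_scale q u) p = q * Poly_Mapping.lookup u p"
  by (simp add: Poly_Mapping.map.rep_eq when_def)

lemma free_scale_single: "free_scale q (Poly_Mapping.single p c) = Poly_Mapping.single p (q * c)"
  by (rule poly_mapping_eqI) (simp add: lookup_free_scale lookup_single when_def)

lemma free_scale_add: "free_scale q (u + v) = free_scale q u + free_scale q v"
  by (rule poly_mapping_eqI) (simp add: lookup_free_scale lookup_add algebra_simps)

lemma free_scale_diff: "free_scale q (u - v) = free_scale q u - free_scale q v"
  by (rule poly_mapping_eqI) (simp add: lookup_free_scale lookup_minus algebra_simps)

lemma free_scale_add_left: "free_scale (a + b) u = free_scale a u + free_scale b u"
  by (rule poly_mapping_eqI) (simp add: lookup_free_scale lookup_add algebra_simps)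

lemma free_scale_scale: "free_scale a (free_scale b u) = free_scale (a * b) u"
  by (rule poly_mapping_eqI) (simp add: lookup_free_scale algebra_simps)

lemma free_scale_one: "free_scale 1 u = u"
  by (rule poly_mapping_eqI) (simp add: lookup_free_scale)

lemma free_scale_minus_one: "free_scale (-1) u = - u"
  by (rule poly_mapping_eqI) (simp add: lookup_free_scale)

lemma tensor_rel_scale: "u \<in> tensor_rel \<Longrightarrow> free_scale q u \<in> tensor_rel"
proof (induction rule: tensor_rel.induct)
  case zero
  have "free_scale q 0 = 0"
    by (rule poly_mapping_eqI) (simp add: lookup_free_scale)
  then show ?case
    using tensor_rel.zero by metis
next
  case (scale_left p x y c)
  have "q * (p * c) = p * (q * c)" by simp
  then show ?case
    by (simp only: free_scale_diff free_scale_single) (rule tensor_rel.scale_left)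
next
  case (scale_right x p y c)
  have "q * (p * c) = p * (q * c)" by simp
  then show ?case
    by (simp only: free_scale_diff free_scale_single) (rule tensor_rel.scale_right)
qed (simp_all only: free_scale_diff free_scale_add free_scale_single tensor_rel.intros)

lemma tensor_rel_uminus: "u \<in> tensor_rel \<Longrightarrow> - u \<in> tensor_rel"
  using tensor_rel_scale[of u "-1"] by (simp add: free_scale_minus_one)

lemma equivp_tensor_eq: "equivp tensor_eq"
proof (rule equivpI)
  show "reflp tensor_eq"
    by (simp add: reflp_def tensor_eq_def tensor_rel.zero)
  show "symp tensor_eq"
    using tensor_rel_uminus by (fastforce simp: symp_def tensor_eq_def)
  show "transp tensor_eq"
    using tensor_rel.add by (fastforce simp: transp_def tensor_eq_def)
qed

quotient_type (overloaded) ('a, 'b) tensor =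
    "('a::rat_vector \<times> 'b::rat_vector) \<Rightarrow>\<^sub>0 rat" / tensor_eq
  by (rule equivp_tensor_eq)

instantiation tensor :: (rat_vector, rat_vector) rat_vector
begin

lift_definition zero_tensor :: "('a, 'b) tensor" is 0 .

lift_definition plus_tensor :: "('a, 'b) tensor \<Rightarrow> ('a, 'b) tensor \<Rightarrow> ('a, 'b) tensor" is "(+)"
  unfolding tensor_eq_def by (drule (1) tensor_rel.add) (simp add: algebra_simps)

lift_definition uminus_tensor :: "('a, 'b) tensor \<Rightarrow> ('a, 'b) tensor" is uminus
  unfolding tensor_eq_def by (drule tensor_rel_uminus) (simp add: algebra_simps)

lift_definition minus_tensor :: "('a, 'b) tensor \<Rightarrow> ('a, 'b) tensor \<Rightarrow> ('a, 'b) tensor" is "(-)"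
proof -
  fix u u' v v' :: "('a \<times> 'b) \<Rightarrow>\<^sub>0 rat"
  assume "tensor_eq u u'" "tensor_eq v v'"
  then have "(u - u') + - (v - v') \<in> tensor_rel"
    unfolding tensor_eq_def by (intro tensor_rel.add tensor_rel_uminus)
  then show "tensor_eq (u - v) (u' - v')"
    by (simp add: tensor_eq_def algebra_simps)
qed

lift_definition scaleQ_tensor :: "rat \<Rightarrow> ('a, 'b) tensor \<Rightarrow> ('a, 'b) tensor" is free_scale
  unfolding tensor_eq_def by (drule tensor_rel_scale) (simp add: free_scale_diff)

lemma tensor_eq_refl: "tensor_eq u u"
  by (simp add: tensor_eq_def tensor_rel.zero)

instance
proof
  fix a b :: rat and x y z :: "('a, 'b) tensor"
  show "x + y + z = x + (y + z)" by transfer (simp add: add.assoc tensor_eq_refl)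
  show "x + y = y + x" by transfer (simp add: add.commute tensor_eq_refl)
  show "0 + x = x" by transfer (simp add: tensor_eq_refl)
  show "- x + x = 0" by transfer (simp add: tensor_eq_refl)
  show "x - y = x + - y" by transfer (simp add: tensor_eq_refl)
  show "a *\<^sub>Q (x + y) = a *\<^sub>Q x + a *\<^sub>Q y"
    by transfer (simp add: free_scale_add tensor_eq_refl)
  show "(a + b) *\<^sub>Q x = a *\<^sub>Q x + b *\<^sub>Q x"
    by transfer (simp add: free_scale_add_left tensor_eq_refl)
  show "a *\<^sub>Q b *\<^sub>Q x = (a * b) *\<^sub>Q x"
    by transfer (simp add: free_scale_scale tensor_eq_refl)
  show "1 *\<^sub>Q x = x"
    by transfer (simp add: free_scale_one tensor_eq_refl)
qed

end

lift_definition tens :: "'a::rat_vector \<Rightarrow> 'b::rat_vector \<Rightarrow> ('a, 'b) tensor"  (infixr \<open>\<otimes>\<^sub>Q\<close> 76)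
  is "\<lambda>x y. Poly_Mapping.single (x, y) 1" .

lemma rat_bilinear_tens: "rat_bilinear (\<otimes>\<^sub>Q)"
proof -
  have 1: "(x + x') \<otimes>\<^sub>Q y = x \<otimes>\<^sub>Q y + x' \<otimes>\<^sub>Q y" for x x' :: 'a and y :: 'b
    by transfer (use tensor_rel.add_left in \<open>fastforce simp: tensor_eq_def algebra_simps\<close>)
  have 2: "x \<otimes>\<^sub>Q (y + y') = x \<otimes>\<^sub>Q y + x \<otimes>\<^sub>Q y'" for x :: 'a and y y' :: 'b
    by transfer (use tensor_rel.add_right in \<open>fastforce simp: tensor_eq_def algebra_simps\<close>)
  have 3: "(q *\<^sub>Q x) \<otimes>\<^sub>Q y = q *\<^sub>Q (x \<otimes>\<^sub>Q y)" for q and x :: 'a and y :: 'b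
    by transfer (use tensor_rel.scale_left[where c = 1] in
        \<open>simp add: tensor_eq_def free_scale_single\<close>)
  have 4: "x \<otimes>\<^sub>Q (q *\<^sub>Q y) = q *\<^sub>Q (x \<otimes>\<^sub>Q y)" for q and x :: 'a and y :: 'b
    by transfer (use tensor_rel.scale_right[where c = 1] in
        \<open>simp add: tensor_eq_def free_scale_single\<close>)
  show ?thesis
    unfolding rat_bilinear_def by (intro conjI allI; unfold_locales; fact 1 2 3 4)
qed

definition free_lift ::
  "('a::rat_vector \<Rightarrow> 'b::rat_vector \<Rightarrow> 'c::rat_vector) \<Rightarrow> (('a \<times> 'b) \<Rightarrow>\<^sub>0 rat) \<Rightarrow> 'c" where
  "free_lift f u = (\<Sum>p\<in>Poly_Mapping.keys u. Poly_Mapping.lookup u p *\<^sub>Q f (fst p) (snd p))"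

text \<open>The linear map induced by a bilinear map; it depends on the representative, hence is
  meaningless, when \<open>f\<close> is not bilinear.\<close>

definition tensor_lift ::
  "('a::rat_vector \<Rightarrow> 'b::rat_vector \<Rightarrow> 'c::rat_vector) \<Rightarrow> ('a, 'b) tensor \<Rightarrow> 'c" where
  "tensor_lift f t = free_lift f (rep_tensor t)"

lemma free_lift_superset:
  assumes "finite S" "Poly_Mapping.keys u \<subseteq> S"
  shows "free_lift f u = (\<Sum>p\<in>S. Poly_Mapping.lookup u p *\<^sub>Q f (fst p) (snd p))"
  unfolding free_lift_def using assms
  by (intro sum.mono_neutral_left) (auto simp: in_keys_iff)

lemma free_lift_add: "free_lift f (u + v) = free_lift f u + free_lift f v"
proof -
  let ?S = "Poly_Mapping.keys u \<union> Poly_Mapping.keys v"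
  have "Poly_Mapping.keys (u + v) \<subseteq> ?S" by (rule Poly_Mapping.keys_add)
  then show ?thesis
    by (simp add: free_lift_superset[of ?S] lookup_add scaleQ_add_left sum.distrib)
qed

lemma free_lift_scale: "free_lift f (free_scale q u) = q *\<^sub>Q free_lift f u"
proof -
  have "Poly_Mapping.keys (free_scale q u) \<subseteq> Poly_Mapping.keys u"
    by (auto simp: in_keys_iff lookup_free_scale)
  then show ?thesis
    by (simp add: free_lift_superset[of "Poly_Mapping.keys u"] lookup_free_scale rat_vector.scale_sum_right)
qed

lemma free_lift_diff: "free_lift f (u - v) = free_lift f u - free_lift f v"
  by (metis add_diff_cancel diff_add_cancel free_lift_add)

lemma free_lift_single: "free_lift f (Poly_Mapping.single (x, y) c) = c *\<^sub>Q f x y"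
  by (simp add: free_lift_def)

lemma free_lift_tensor_rel:
  assumes "rat_bilinear f" "u \<in> tensor_rel"
  shows "free_lift f u = 0"
proof -
  interpret l: Vector_Spaces.linear scaleQ scaleQ "\<lambda>x. f x y" for y
    using assms(1) by (simp add: rat_bilinear_def)
  interpret r: Vector_Spaces.linear scaleQ scaleQ "f x" for x
    using assms(1) by (simp add: rat_bilinear_def)
  show ?thesis
    using assms(2)
    by induction (simp_all add: free_lift_add free_lift_diff free_lift_single l.add r.add l.scale
        r.scale scaleQ_add_right mult.commute, simp add: free_lift_def)
qed

lemma tensor_lift_abs:
  assumes "rat_bilinear f"
  shows "tensor_lift f (abs_tensor u) = free_lift f u"
proof -
  have "tensor_eq (rep_tensor (abs_tensor u)) u"
    by (rule Quotient3_rep_abs[OF Quotient3_tensor]) (rule tensor_eq_refl)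
  then have "free_lift f (rep_tensor (abs_tensor u) - u) = 0"
    unfolding tensor_eq_def by (rule free_lift_tensor_rel[OF assms])
  then show ?thesis
    by (simp add: tensor_lift_def free_lift_diff)
qed

lemma tensor_lift_tens: "rat_bilinear f \<Longrightarrow> tensor_lift f (x \<otimes>\<^sub>Q y) = f x y"
  by (simp add: tens.abs_eq tensor_lift_abs free_lift_single)

lemma tensor_abs_exhaust: obtains u where "t = abs_tensor u"
  using Quotient3_abs_rep[OF Quotient3_tensor] by metis

lemma rat_linear_tensor_lift:
  assumes "rat_bilinear f"
  shows "rat_linear (tensor_lift f)"
proof (unfold_locales)
  fix s t :: "('a, 'b) tensor" and q
  obtain u v where "s = abs_tensor u" "t = abs_tensor v"
    by (meson tensor_abs_exhaust)
  then show "tensor_lift f (s + t) = tensor_lift f s + tensor_lift f t"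
    and "tensor_lift f (q *\<^sub>Q s) = q *\<^sub>Q tensor_lift f s"
    by (simp_all add: plus_tensor.abs_eq scaleQ_tensor.abs_eq tensor_lift_abs[OF assms]
        free_lift_add free_lift_scale)
qed

lemma tensor_lift_unique:
  fixes g :: "('a::rat_vector, 'b::rat_vector) tensor \<Rightarrow> 'c::rat_vector"
  assumes "rat_linear g"
  shows "g t = tensor_lift (\<lambda>x y. g (x \<otimes>\<^sub>Q y)) t"
proof -
  interpret g: Vector_Spaces.linear scaleQ scaleQ g by fact
  interpret l: Vector_Spaces.linear scaleQ scaleQ "\<lambda>x. x \<otimes>\<^sub>Q y :: ('a, 'b) tensor" for y
    by (simp add: rat_bilinear_tens[unfolded rat_bilinear_def])
  interpret r: Vector_Spaces.linear scaleQ scaleQ "\<lambda>y. x \<otimes>\<^sub>Q y :: ('a, 'b) tensor" for x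
    by (simp add: rat_bilinear_tens[unfolded rat_bilinear_def])
  let ?f = "\<lambda>x y. g (x \<otimes>\<^sub>Q y)"
  have f: "rat_bilinear ?f"
    unfolding rat_bilinear_def
    by (intro conjI allI; unfold_locales) (simp_all add: l.add r.add l.scale r.scale g.add g.scale)
  have "g (abs_tensor u) = free_lift ?f u" for u
  proof (induction u rule: update_induct)
    case const
    show ?case
      using g.zero by (simp add: free_lift_def zero_tensor.abs_eq)
  next
    case (update u p c)
    have "Poly_Mapping.update p c u = u + Poly_Mapping.single p c"
      using update.hyps
      by (intro poly_mapping_eqI)
        (auto simp: lookup_update lookup_add lookup_single when_def in_keys_iff)
    moreover have "g (abs_tensor (Poly_Mapping.single p c)) = c *\<^sub>Q g (fst p \<otimes>\<^sub>Q snd p)"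
      by (simp flip: g.scale add: tens.abs_eq scaleQ_tensor.abs_eq free_scale_single)
    ultimately show ?case
      using update.IH free_lift_single[of ?f "fst p" "snd p"]
      by (simp add: free_lift_add g.add flip: plus_tensor.abs_eq)
  qed
  then show ?thesis
    by (metis f tensor_lift_abs tensor_abs_exhaust)
qed

definition tensor_swap :: "('a::rat_vector, 'b::rat_vector) tensor \<Rightarrow> ('b, 'a) tensor" where
  "tensor_swap = tensor_lift (\<lambda>x y. y \<otimes>\<^sub>Q x)"

definition tensor_map :: "('a::rat_vector \<Rightarrow> 'c::rat_vector) \<Rightarrow> ('b::rat_vector \<Rightarrow> 'd::rat_vector)
    \<Rightarrow> ('a, 'b) tensor \<Rightarrow> ('c, 'd) tensor" where
  "tensor_map f g = tensor_lift (\<lambda>x y. f x \<otimes>\<^sub>Q g y)"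

definition tensor_assoc :: "(('a::rat_vector, 'b::rat_vector) tensor, 'c::rat_vector) tensor
    \<Rightarrow> ('a, ('b, 'c) tensor) tensor" where
  "tensor_assoc = tensor_lift (\<lambda>t z. tensor_lift (\<lambda>x y. x \<otimes>\<^sub>Q y \<otimes>\<^sub>Q z) t)"

definition tensor_mult :: "('a::rat_algebra_1, 'b::rat_algebra_1) tensor \<Rightarrow> ('a, 'b) tensor
    \<Rightarrow> ('a, 'b) tensor" where
  "tensor_mult s t = tensor_lift (\<lambda>x y. tensor_lift (\<lambda>x' y'. (x * x') \<otimes>\<^sub>Q (y * y')) t) s"

lemma rat_linear_iff:
  "rat_linear f \<longleftrightarrow> (\<forall>x y. f (x + y) = f x + f y) \<and> (\<forall>c x. f (c *\<^sub>Q x) = c *\<^sub>Q f x)"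
  by (simp add: Vector_Spaces.linear_iff rat_vector.vector_space_axioms)

lemma rat_bilinearI:
  assumes "\<And>x x' y. f (x + x') y = f x y + f x' y" "\<And>x y y'. f x (y + y') = f x y + f x y'"
    "\<And>q x y. f (q *\<^sub>Q x) y = q *\<^sub>Q f x y" "\<And>q x y. f x (q *\<^sub>Q y) = q *\<^sub>Q f x y"
  shows "rat_bilinear f"
  unfolding rat_bilinear_def by (intro conjI allI; unfold_locales; fact assms)

lemma rat_bilinearD:
  assumes "rat_bilinear f"
  shows "f (x + x') y = f x y + f x' y" "f x (y + y') = f x y + f x y'"
    "f (q *\<^sub>Q x) y = q *\<^sub>Q f x y" "f x (q *\<^sub>Q y) = q *\<^sub>Q f x y"
  using assms unfolding rat_bilinear_def
  by (simp_all add: Vector_Spaces.linear_iff)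

lemmas tens_simps = rat_bilinearD[OF rat_bilinear_tens]

lemma tensor_swap_tens: "tensor_swap (x \<otimes>\<^sub>Q y) = y \<otimes>\<^sub>Q x"
  unfolding tensor_swap_def by (intro tensor_lift_tens rat_bilinearI tens_simps)

lemma tensor_map_tens:
  "rat_linear f \<Longrightarrow> rat_linear g \<Longrightarrow> tensor_map f g (x \<otimes>\<^sub>Q y) = f x \<otimes>\<^sub>Q g y"
  unfolding tensor_map_def
  by (intro tensor_lift_tens rat_bilinearI) (simp_all add: Vector_Spaces.linear_iff tens_simps)

lemma tensor_lift_linear_family:
  assumes "\<And>z. rat_bilinear (\<lambda>x y. f x y z)" "\<And>x y. rat_linear (f x y)"
  shows "rat_bilinear (\<lambda>t z. tensor_lift (\<lambda>x y. f x y z) t)"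
proof (rule rat_bilinearI)
  fix t t' z z' q
  show "tensor_lift (\<lambda>x y. f x y z) (t + t') = tensor_lift (\<lambda>x y. f x y z) t + tensor_lift (\<lambda>x y. f x y z) t'"
   and "tensor_lift (\<lambda>x y. f x y z) (q *\<^sub>Q t) = q *\<^sub>Q tensor_lift (\<lambda>x y. f x y z) t"
    using rat_linear_tensor_lift[OF assms(1)[of z]] by (simp_all add: Vector_Spaces.linear_iff)
  have "tensor_lift (\<lambda>x y. f x y (z + z')) t = free_lift (\<lambda>x y. f x y z) (rep_tensor t) + free_lift (\<lambda>x y. f x y z') (rep_tensor t)"
    using assms(2) unfolding tensor_lift_def free_lift_def
    by (simp add: Vector_Spaces.linear_iff scaleQ_add_right sum.distrib)
  then show "tensor_lift (\<lambda>x y. f x y (z + z')) t = tensor_lift (\<lambda>x y. f x y z) t + tensor_lift (\<lambda>x y. f x y z') t"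
    by (simp add: tensor_lift_def)
  have "tensor_lift (\<lambda>x y. f x y (q *\<^sub>Q z)) t = q *\<^sub>Q free_lift (\<lambda>x y. f x y z) (rep_tensor t)"
    using assms(2) unfolding tensor_lift_def free_lift_def
    by (simp add: Vector_Spaces.linear_iff rat_vector.scale_sum_right scaleQ_scaleQ mult.commute)
  then show "tensor_lift (\<lambda>x y. f x y (q *\<^sub>Q z)) t = q *\<^sub>Q tensor_lift (\<lambda>x y. f x y z) t"
    by (simp add: tensor_lift_def)
qed

lemma tensor_assoc_tens: "tensor_assoc ((x \<otimes>\<^sub>Q y) \<otimes>\<^sub>Q z) = x \<otimes>\<^sub>Q y \<otimes>\<^sub>Q z"
proof -
  have "tensor_assoc ((x \<otimes>\<^sub>Q y) \<otimes>\<^sub>Q z) = tensor_lift (\<lambda>x y. x \<otimes>\<^sub>Q y \<otimes>\<^sub>Q z) (x \<otimes>\<^sub>Q y)"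
    unfolding tensor_assoc_def
    by (intro tensor_lift_tens tensor_lift_linear_family rat_bilinearI) (auto simp: tens_simps rat_linear_iff)
  also have "\<dots> = x \<otimes>\<^sub>Q y \<otimes>\<^sub>Q z"
    by (intro tensor_lift_tens rat_bilinearI) (auto simp: tens_simps)
  finally show ?thesis .
qed

lemma tensor_mult_tens: 
  "tensor_mult (x \<otimes>\<^sub>Q y) (x' \<otimes>\<^sub>Q y') = (x * x') \<otimes>\<^sub>Q (y * y')"
proof -
  have b: "rat_bilinear (\<lambda>x' y'. (x * x') \<otimes>\<^sub>Q (y * y'))" for x :: 'a and y :: 'b
    by (intro rat_bilinearI) (simp_all add: distrib_left tens_simps mult_scaleQ_right)
  let ?t = "x' \<otimes>\<^sub>Q y'"
  have "rat_bilinear (\<lambda>x y. tensor_lift (\<lambda>x' y'. (x * x') \<otimes>\<^sub>Q (y * y')) ?t)"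
    by (subst tensor_lift_tens[OF b]) (intro rat_bilinearI; simp add: distrib_right tens_simps mult_scaleQ_left)
  then have "tensor_mult (x \<otimes>\<^sub>Q y) ?t = tensor_lift (\<lambda>x' y'. (x * x') \<otimes>\<^sub>Q (y * y')) ?t"
    unfolding tensor_mult_def by (rule tensor_lift_tens)
  then show ?thesis by (simp add: tensor_lift_tens[OF b])
qed


section \<open>Hopf algebras and Hopf-Galois structures\<close>

locale rat_hopf_algebra =
  fixes comult :: "'h::rat_algebra_1 \<Rightarrow> ('h, 'h) tensor"
    and counit :: "'h \<Rightarrow> rat"
    and antipode :: "'h \<Rightarrow> 'h"
  assumes comult_linear: "rat_linear comult"
    and counit_linear: "Vector_Spaces.linear scaleQ (*) counit"
    and antipode_linear: "rat_linear antipode"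
    and coassoc: "tensor_assoc (tensor_map comult id (comult h)) = tensor_map id comult (comult h)"
    and counit_left: "tensor_lift (\<lambda>a b. counit a *\<^sub>Q b) (comult h) = h"
    and counit_right: "tensor_lift (\<lambda>a b. counit b *\<^sub>Q a) (comult h) = h"
    and comult_one: "comult 1 = 1 \<otimes>\<^sub>Q 1"
    and comult_mult: "comult (g * h) = tensor_mult (comult g) (comult h)"
    and counit_one: "counit 1 = 1"
    and counit_mult: "counit (g * h) = counit g * counit h"
    and antipode_left: "tensor_lift (\<lambda>a b. antipode a * b) (comult h) = counit h *\<^sub>Q 1"
    and antipode_right: "tensor_lift (\<lambda>a b. a * antipode b) (comult h) = counit h *\<^sub>Q 1"

locale hopf_galois_structure = rat_hopf_algebra comult counit antipode
  for comult :: "'h::rat_algebra_1 \<Rightarrow> ('h, 'h) tensor"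
    and counit :: "'h \<Rightarrow> rat"
    and antipode :: "'h \<Rightarrow> 'h" +
  fixes act :: "'h \<Rightarrow> 'l::number_field \<Rightarrow> 'l"
  assumes finite_dimensional: "\<exists>S::'h set. finite S \<and> rat_span S = UNIV"
    and cocommutative: "tensor_swap (comult h) = comult h"
    and act_bilinear: "rat_bilinear act"
    and act_one_left: "act 1 x = x"
    and act_mult_left: "act (g * h) x = act g (act h x)"
    and act_one_right: "act h 1 = counit h *\<^sub>Q 1"
    and act_mult_right: "act h (x * y) = tensor_lift (\<lambda>a b. act a x * act b y) (comult h)"
    and canonical_bij:
      "bij_betw (\<lambda>t y. tensor_lift (\<lambda>x h. x * act h y) t) (UNIV :: ('l, 'h) tensor set)
        {f. rat_linear f}"


section \<open>Orders, associated orders and free generators\<close>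

global_interpretation int_module: Modules.module "\<lambda>k x. of_int k * x :: 'a::ring_1"
  defines int_dependent = int_module.dependent
    and int_span = int_module.span
  by unfold_locales (simp_all add: algebra_simps)

definition is_int_order :: "'l::number_field set \<Rightarrow> bool" where
  "is_int_order R \<longleftrightarrow>
    1 \<in> R \<and> (\<forall>x\<in>R. \<forall>y\<in>R. x - y \<in> R) \<and> (\<forall>x\<in>R. \<forall>y\<in>R. x * y \<in> R) \<and>
    (\<exists>S. finite S \<and> int_span S = R) \<and>
    (\<exists>S\<subseteq>R. \<not> rat_dependent S \<and> rat_span S = UNIV)"

definition associated_order :: "('h \<Rightarrow> 'l \<Rightarrow> 'l) \<Rightarrow> 'l set \<Rightarrow> 'h set" where
  "associated_order act R = {h. \<forall>x\<in>R. act h x \<in> R}"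

text \<open>\<open>{\<beta>}\<close> is a basis of the module \<open>R\<close> over its associated order: it generates, and it is linearly
  independent.\<close>

definition is_free_generator :: "('h::zero \<Rightarrow> 'l::zero \<Rightarrow> 'l) \<Rightarrow> 'l set \<Rightarrow> 'l \<Rightarrow> bool" where
  "is_free_generator act R \<beta> \<longleftrightarrow>
    \<beta> \<in> R \<and> (\<lambda>h. act h \<beta>) ` associated_order act R = R \<and>
    (\<forall>h\<in>associated_order act R. act h \<beta> = 0 \<longrightarrow> h = 0)"


section \<open>The matrices of the action\<close>

text \<open>Bases are families indexed by \<open>{..<n}\<close>; accordingly all indices start at \<open>0\<close>.\<close>

definition is_rat_basis :: "nat \<Rightarrow> (nat \<Rightarrow> 'a::rat_vector) \<Rightarrow> bool" where
  "is_rat_basis n w \<longleftrightarrow>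
    inj_on w {..<n} \<and> \<not> rat_dependent (w ` {..<n}) \<and> rat_span (w ` {..<n}) = UNIV"

definition is_int_basis :: "nat \<Rightarrow> (nat \<Rightarrow> 'a::ring_1) \<Rightarrow> 'a set \<Rightarrow> bool" where
  "is_int_basis n \<gamma> R \<longleftrightarrow>
    inj_on \<gamma> {..<n} \<and> \<not> int_dependent (\<gamma> ` {..<n}) \<and> int_span (\<gamma> ` {..<n}) = R"

definition coordinate :: "nat \<Rightarrow> (nat \<Rightarrow> 'a::rat_vector) \<Rightarrow> 'a \<Rightarrow> nat \<Rightarrow> rat" where
  "coordinate n \<gamma> x k = rat_representation (\<gamma> ` {..<n}) x (\<gamma> k)"

definition action_matrix_at ::
  "nat \<Rightarrow> ('h \<Rightarrow> 'l \<Rightarrow> 'l) \<Rightarrow> (nat \<Rightarrow> 'h) \<Rightarrow> (nat \<Rightarrow> 'l::rat_vector) \<Rightarrow> nat \<Rightarrow> rat mat" where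
  "action_matrix_at n act w \<gamma> j = mat n n (\<lambda>(k, i). coordinate n \<gamma> (act (w i) (\<gamma> j)) k)"

definition element_matrix ::
  "nat \<Rightarrow> ('h \<Rightarrow> 'l \<Rightarrow> 'l) \<Rightarrow> (nat \<Rightarrow> 'h) \<Rightarrow> (nat \<Rightarrow> 'l::rat_vector) \<Rightarrow> 'l \<Rightarrow> rat mat" where
  "element_matrix n act w \<gamma> \<beta> =
    mat n n (\<lambda>(k, i). \<Sum>j<n. coordinate n \<gamma> \<beta> j * action_matrix_at n act w \<gamma> j $$ (k, i))"

text \<open>Row \<open>j * n + k\<close> of the stacked matrix is row \<open>k\<close> of the \<open>j\<close>-th block.\<close>

definition action_matrix ::
  "nat \<Rightarrow> ('h \<Rightarrow> 'l \<Rightarrow> 'l) \<Rightarrow> (nat \<Rightarrow> 'h) \<Rightarrow> (nat \<Rightarrow> 'l::rat_vector) \<Rightarrow> rat mat" where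
  "action_matrix n act w \<gamma> =
    mat (n\<^sup>2) n (\<lambda>(r, i). action_matrix_at n act w \<gamma> (r div n) $$ (r mod n, i))"

definition is_reduced_matrix :: "nat \<Rightarrow> rat mat \<Rightarrow> rat mat \<Rightarrow> bool" where
  "is_reduced_matrix n M D \<longleftrightarrow>
    D \<in> carrier_mat n n \<and>
    (\<exists>U :: int mat. U \<in> carrier_mat (n\<^sup>2) (n\<^sup>2) \<and> invertible_mat U \<and>
      map_mat of_int U * M = D @\<^sub>r 0\<^sub>m (n\<^sup>2 - n) n)"

text \<open>The value shared by all reduced matrices.\<close>

definition reduced_index ::
  "nat \<Rightarrow> ('h \<Rightarrow> 'l \<Rightarrow> 'l) \<Rightarrow> (nat \<Rightarrow> 'h) \<Rightarrow> (nat \<Rightarrow> 'l::rat_vector) \<Rightarrow> rat" where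
  "reduced_index n act w \<gamma> =
    (THE d. \<exists>D. is_reduced_matrix n (action_matrix n act w \<gamma>) D \<and> d = \<bar>det D\<bar>)"

end

theory Submission
  imports Defs
begin

text \<open>In coordinates with respect to \<open>W\<close> and \<open>B\<close>, the order \<open>R\<close> is \<open>\<int>\<^sup>n\<close> and an element with coordinate
  vector \<open>x\<close> lies in the associated order iff \<open>M x\<close> is integral. Unimodular row operations do not
  affect this, so it is equivalent to integrality of \<open>D x\<close> for a reduced matrix \<open>D\<close>, which is
  invertible because the action is faithful. Since \<open>E = M\<^sub>\<beta>\<close> is the matrix of \<open>h \<mapsto> h \<cdot> \<beta>\<close>, the element
  \<open>\<beta>\<close> is a free generator iff \<open>E\<close> maps \<open>D\<inverse> \<int>\<^sup>n\<close> bijectively onto \<open>\<int>\<^sup>n\<close>, i.e. iff the integral matrix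
  \<open>E D\<inverse>\<close> is unimodular, i.e. iff \<open>det E = \<plusminus> det D\<close>.\<close>

section \<open>Existence of reduced matrices\<close>

lemma invertible_matE:
  fixes A :: "'a::comm_ring_1 mat"
  assumes "invertible_mat A" "A \<in> carrier_mat n n"
  obtains B where "B \<in> carrier_mat n n" "A * B = 1\<^sub>m n" "B * A = 1\<^sub>m n"
proof -
  obtain B where B: "A * B = 1\<^sub>m n" "B * A = 1\<^sub>m (dim_row B)"
    using assms by (auto simp: invertible_mat_def inverts_mat_def)
  have "dim_row B = n"
    using arg_cong[OF B(2), of dim_col] assms by simp
  moreover have "dim_col B = n"
    using arg_cong[OF B(1), of dim_col] by simp
  ultimately show thesis using that[of B] B by auto
qed

text \<open>Multiplicativity of the determinant gives one direction; for the other, the adjugate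
  scaled by an inverse of the determinant is an explicit inverse. Over the integers the condition
  reads \<open>det A = \<plusminus>1\<close>, over the rationals
  \<open>det A \<noteq> 0\<close>.\<close>

lemma invertible_mat_iff_det_dvd_one:
  fixes A :: "'a::comm_ring_1 mat"
  assumes A: "A \<in> carrier_mat n n"
  shows "invertible_mat A \<longleftrightarrow> det A dvd 1"
proof
  assume "invertible_mat A"
  then obtain B where B: "B \<in> carrier_mat n n" "A * B = 1\<^sub>m n"
    using invertible_matE A by metis
  then have "det A * det B = 1"
    using det_mult[OF A B(1)] B(2) by simp
  then show "det A dvd 1" by (metis dvd_triv_left)
next
  assume "det A dvd 1"
  then obtain c where c: "1 = det A * c" by (elim dvdE)
  let ?B = "c \<cdot>\<^sub>m adj_mat A"
  note adj = adj_mat[OF A]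
  have "A * ?B = 1\<^sub>m n" "?B * A = 1\<^sub>m n"
    using A adj c by (auto simp: mult_smult_distrib[OF A adj(1)] mult_smult_assoc_mat[OF adj(1) A]
        mult.commute intro!: eq_matI)
  then show "invertible_mat A"
    using A adj(1) by (auto simp: invertible_mat_def inverts_mat_def)
qed

section \<open>Unimodular row equivalence over the integers\<close>

definition row_equivalent :: "nat \<Rightarrow> int mat \<Rightarrow> int mat \<Rightarrow> bool" where
  "row_equivalent m A B \<longleftrightarrow> (\<exists>U\<in>carrier_mat m m. det U dvd 1 \<and> U * A = B)"

lemma row_equivalent_refl: "A \<in> carrier_mat m n \<Longrightarrow> row_equivalent m A A"
  unfolding row_equivalent_def by (intro bexI[of _ "1\<^sub>m m"]) auto

lemma row_equivalent_trans:
  assumes A: "A \<in> carrier_mat m n" and "row_equivalent m A B" "row_equivalent m B C"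
  shows "row_equivalent m A C"
proof -
  obtain U V where U: "U \<in> carrier_mat m m" "det U dvd 1" "U * A = B"
    and V: "V \<in> carrier_mat m m" "det V dvd 1" "V * B = C"
    using assms by (auto simp: row_equivalent_def)
  have "V * U * A = C" using U V A by auto
  moreover have "det (V * U) dvd 1"
    using U V by (simp add: det_mult[OF V(1) U(1)] abs_mult)
  ultimately show ?thesis
    using U V unfolding row_equivalent_def by (intro bexI[of _ "V * U"]) auto
qed

lemma row_equivalent_addrow:
  assumes "A \<in> carrier_mat m n" "k \<noteq> l" "l < m"
  shows "row_equivalent m A (addrow a k l A)"
  unfolding row_equivalent_def
  by (intro bexI[of _ "addrow_mat m a k l"])
    (use assms in \<open>simp_all add: det_addrow_mat addrow_mat[symmetric]\<close>)

lemma row_equivalent_swaprows: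
  assumes "A \<in> carrier_mat m n" "k < m" "l < m"
  shows "row_equivalent m A (swaprows k l A)"
proof (cases "k = l")
  case True
  then have "swaprows k l A = A"
    using assms by (intro eq_matI) auto
  then show ?thesis using row_equivalent_refl assms by simp
next
  case False
  then show ?thesis
    unfolding row_equivalent_def
    by (intro bexI[of _ "swaprows_mat m k l"])
      (use assms in \<open>simp_all add: det_swaprows_mat swaprows_mat[symmetric]\<close>)
qed

lemma row_equivalent_carrier:
  "row_equivalent m A B \<Longrightarrow> A \<in> carrier_mat m n \<Longrightarrow> B \<in> carrier_mat m n"
  by (auto simp: row_equivalent_def)

text \<open>Among all matrices reachable without disturbing the first \<open>k\<close> columns, take one whose
  remaining part of column \<open>k\<close> is smallest: two nonzero entries there could still be decreased by
  a Euclidean step.\<close>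

lemma row_equivalent_upper_triangular_step:
  assumes A: "A \<in> carrier_mat m n" and k: "k < n" "n \<le> m"
    and zero: "\<forall>j<k. \<forall>i<m. j < i \<longrightarrow> A $$ (i, j) = 0"
  obtains B where "row_equivalent m A B" "\<forall>j<Suc k. \<forall>i<m. j < i \<longrightarrow> B $$ (i, j) = 0"
proof -
  define P where "P B \<longleftrightarrow> row_equivalent m A B \<and> (\<forall>j<k. \<forall>i<m. j < i \<longrightarrow> B $$ (i, j) = 0)" for B
  define f where "f B = (\<Sum>i\<in>{k..<m}. nat \<bar>B $$ (i, k)\<bar>)" for B :: "int mat"
  have "P A" using A zero row_equivalent_refl by (auto simp: P_def)
  then obtain B where B: "P B" and min: "\<And>C. P C \<Longrightarrow> f B \<le> f C"
    using ex_has_least_nat[of P A f] by metis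
  have Bc: "B \<in> carrier_mat m n"
    using B A row_equivalent_carrier by (auto simp: P_def)
  have step: False
    if il: "i \<in> {k..<m}" "l \<in> {k..<m}" "i \<noteq> l" and nz: "B $$ (l, k) \<noteq> 0"
      and le: "\<bar>B $$ (l, k)\<bar> \<le> \<bar>B $$ (i, k)\<bar>" for i l
  proof -
    \<comment> \<open>With this \<open>q\<close>, the row operation replaces entry
      \<open>(i, k)\<close> by its remainder modulo entry \<open>(l, k)\<close>. Rows
      \<open>i\<close> and \<open>l\<close> both vanish in the columns before \<open>k\<close>, so
      those columns stay as they are.\<close>
    define q where "q = - (B $$ (i, k) div B $$ (l, k))"
    let ?C = "addrow q i l B"
    have "row_equivalent m B ?C"
      using Bc il by (intro row_equivalent_addrow) auto
    then have "P ?C"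
      using B Bc il k row_equivalent_trans[OF A] unfolding P_def by auto
    moreover have "f ?C < f B"
      unfolding f_def
    proof (rule sum_strict_mono_ex1)
      have eq: "?C $$ (i, k) = B $$ (i, k) mod B $$ (l, k)"
        using Bc il k by (simp add: q_def minus_div_mult_eq_mod[symmetric])
      have lt: "\<bar>?C $$ (i, k)\<bar> < \<bar>B $$ (i, k)\<bar>"
        using abs_mod_less[OF nz, of "B $$ (i, k)"] le unfolding eq by linarith
      then show "\<exists>x\<in>{k..<m}. nat \<bar>?C $$ (x, k)\<bar> < nat \<bar>B $$ (x, k)\<bar>"
        using il by (intro bexI[of _ i]) auto
      show "\<forall>x\<in>{k..<m}. nat \<bar>?C $$ (x, k)\<bar> \<le> nat \<bar>B $$ (x, k)\<bar>"
      proof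
        fix x assume "x \<in> {k..<m}"
        then show "nat \<bar>?C $$ (x, k)\<bar> \<le> nat \<bar>B $$ (x, k)\<bar>"
          using lt Bc k by (cases "x = i") auto
      qed
    qed simp
    ultimately show False using min by fastforce
  qed
  \<comment> \<open>Of two nonzero entries one is at most as large as the other in absolute value,
    so \<open>step\<close> applies in one of the two orders.\<close>
  have unique: "i = l" if "i \<in> {k..<m}" "l \<in> {k..<m}" "B $$ (i, k) \<noteq> 0" "B $$ (l, k) \<noteq> 0" for i l
    using step[of i l] step[of l i] that by (metis linear)
  show thesis
  proof (cases "\<exists>l\<in>{k..<m}. B $$ (l, k) \<noteq> 0")
    case True
    then obtain l where l: "l \<in> {k..<m}" "B $$ (l, k) \<noteq> 0" by blast
    \<comment> \<open>The swap moves the only nonzero entry of column \<open>k\<close> in rows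
      \<open>k\<close> and beyond onto the diagonal.\<close>
    let ?C = "swaprows k l B"
    have "row_equivalent m B ?C"
      using Bc l k by (intro row_equivalent_swaprows) auto
    then have "row_equivalent m A ?C"
      using B row_equivalent_trans[OF A] unfolding P_def by blast
    moreover have "?C $$ (i, j) = 0" if "j < Suc k" "i < m" "j < i" for i j
    proof (cases "j = k")
      case True
      then show ?thesis
        using unique[of i l] unique[of k l] l that Bc k by (cases "i = l") auto
    next
      case False
      then have "\<forall>i<m. j < i \<longrightarrow> B $$ (i, j) = 0" using B that unfolding P_def by auto
      then show ?thesis using l that False Bc k by auto
    qed
    ultimately show thesis using that[of ?C] by blast
  next
    case False
    then show thesis using that[of B] B by (auto simp: P_def less_Suc_eq)
  qed
qed

lemma row_equivalent_upper_triangular: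
  assumes A: "A \<in> carrier_mat m n" and "k \<le> n" "n \<le> m"
  shows "\<exists>B. row_equivalent m A B \<and> (\<forall>j<k. \<forall>i<m. j < i \<longrightarrow> B $$ (i, j) = 0)"
  using assms(2)
proof (induction k)
  case 0
  then show ?case using row_equivalent_refl[OF A] by auto
next
  case (Suc k)
  then obtain B where B: "row_equivalent m A B" "\<forall>j<k. \<forall>i<m. j < i \<longrightarrow> B $$ (i, j) = 0"
    by auto
  obtain C where "row_equivalent m B C" "\<forall>j<Suc k. \<forall>i<m. j < i \<longrightarrow> C $$ (i, j) = 0"
    using row_equivalent_upper_triangular_step[OF row_equivalent_carrier[OF B(1) A] _ assms(3) B(2)]
      Suc.prems by (metis Suc_le_lessD)
  then show ?case using row_equivalent_trans[OF A B(1)] by blast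
qed

text \<open>Multiplication by the product of the denominators of all entries makes the matrix
  integral; \<open>c\<close> is the reciprocal of that product.\<close>

lemma rat_mat_common_denominator:
  assumes M: "(M :: rat mat) \<in> carrier_mat m n"
  obtains c A where "c \<noteq> 0" "A \<in> carrier_mat m n" "M = c \<cdot>\<^sub>m map_mat of_int A"
proof -
  let ?I = "{..<m} \<times> {..<n}"
  define d where "d = (\<Prod>p\<in>?I. snd (quotient_of (M $$ p)))"
  have pos: "snd (quotient_of (M $$ p)) > 0" for p
    using quotient_of_denom_pos' by blast
  then have d: "d > 0" unfolding d_def by (intro prod_pos) auto
  have "of_int d * M $$ p \<in> \<int>" if "p \<in> ?I" for p
  proof -
    have "snd (quotient_of (M $$ p)) dvd d"
      unfolding d_def using that by (intro dvd_prodI) auto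
    then obtain e where e: "d = snd (quotient_of (M $$ p)) * e" ..
    have "M $$ p = of_int (fst (quotient_of (M $$ p))) / of_int (snd (quotient_of (M $$ p)))"
      by (metis quotient_of_div prod.collapse)
    then have "of_int d * M $$ p = of_int (e * fst (quotient_of (M $$ p)))"
      using pos[of p] unfolding e by (simp add: field_simps)
    then show ?thesis by simp
  qed
  then have "M = (1 / of_int d) \<cdot>\<^sub>m map_mat of_int (mat m n (\<lambda>p. \<lfloor>of_int d * M $$ p\<rfloor>))"
    using M d by (intro eq_matI) (auto simp: of_int_floor[symmetric] field_simps)
  then show thesis using d that[of "1 / of_int d" "mat m n (\<lambda>p. \<lfloor>of_int d * M $$ p\<rfloor>)"] by auto
qed

text \<open>A rational scalar commutes with row operations, so it suffices to triangularise the
  integer matrix left after clearing denominators. Zeros below the diagonal in all \<open>n\<close>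
  columns empty the rows from index \<open>n\<close> on; the first \<open>n\<close> rows, rescaled,
  form \<open>D\<close>.\<close>

lemma reduced_matrix_exists:
  assumes M: "M \<in> carrier_mat (n\<^sup>2) n"
  obtains D where "is_reduced_matrix n M D"
proof -
  \<comment> \<open>This makes the truncated subtraction in \<open>n\<^sup>2 - n\<close> exact, also
    for \<open>n = 0\<close>, so that the stacked matrix has \<open>n\<^sup>2\<close> rows.\<close>
  have nn: "n \<le> n\<^sup>2" by (simp add: power2_eq_square)
  obtain c A where c: "c \<noteq> 0" and A: "A \<in> carrier_mat (n\<^sup>2) n" and MA: "M = c \<cdot>\<^sub>m map_mat of_int A"
    using rat_mat_common_denominator[OF M] .
  obtain B where "row_equivalent (n\<^sup>2) A B" and B: "\<forall>j<n. \<forall>i<n\<^sup>2. j < i \<longrightarrow> B $$ (i, j) = 0"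
    using row_equivalent_upper_triangular[OF A order_refl nn] by blast
  then obtain U where U: "U \<in> carrier_mat (n\<^sup>2) (n\<^sup>2)" "det U dvd 1" "U * A = B"
    by (auto simp: row_equivalent_def)
  have Bc: "B \<in> carrier_mat (n\<^sup>2) n" using U A by auto
  define D where "D = mat n n (\<lambda>p. c * of_int (B $$ p))"
  have "map_mat of_int U * M = c \<cdot>\<^sub>m map_mat of_int B"
    using U A unfolding MA
    by (simp add: mult_smult_distrib[of _ "n\<^sup>2" "n\<^sup>2"] of_int_hom.mat_hom_mult[OF U(1) A, symmetric])
  also have "\<dots> = D @\<^sub>r 0\<^sub>m (n\<^sup>2 - n) n"
    using Bc B nn by (intro eq_matI) (auto simp: D_def append_rows_def)
  finally have "is_reduced_matrix n M D"
    using U invertible_mat_iff_det_dvd_one[OF U(1)] by (auto simp: is_reduced_matrix_def D_def)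
  then show thesis by (rule that)
qed

section \<open>Integral vectors\<close>

definition integral_vec :: "rat vec \<Rightarrow> bool" where
  "integral_vec v \<longleftrightarrow> (\<exists>z. v = map_vec of_int z)"

lemma integral_vec_iff_Ints: "integral_vec v \<longleftrightarrow> (\<forall>i<dim_vec v. v $ i \<in> \<int>)"
proof
  assume "\<forall>i<dim_vec v. v $ i \<in> \<int>"
  then have "v = map_vec of_int (vec (dim_vec v) (\<lambda>i. \<lfloor>v $ i\<rfloor>))"
    by (intro eq_vecI) (auto simp: of_int_floor)
  then show "integral_vec v" unfolding integral_vec_def ..
qed (auto simp: integral_vec_def)

lemma integral_vec_mult_mat_vec:
  assumes "integral_vec v" "v \<in> carrier_vec n" "A \<in> carrier_mat m n"
  shows "integral_vec (map_mat of_int A *\<^sub>v v)"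
proof -
  obtain z where z: "v = map_vec of_int z" using assms by (auto simp: integral_vec_def)
  then have "z \<in> carrier_vec n" using assms by auto
  then show ?thesis
    unfolding integral_vec_def z using of_int_hom.mult_mat_vec_hom[OF assms(3)] by metis
qed

text \<open>The inverse of \<open>U\<close> is again an integer matrix, and integer matrices
  preserve integral vectors.\<close>

lemma integral_vec_unimodular:
  assumes U: "U \<in> carrier_mat m m" "invertible_mat U" and v: "v \<in> carrier_vec m"
  shows "integral_vec (map_mat of_int U *\<^sub>v v) \<longleftrightarrow> integral_vec v"
proof
  obtain V where V: "V \<in> carrier_mat m m" "V * U = 1\<^sub>m m"
    using invertible_matE U by metis
  have "map_mat of_int V *\<^sub>v (map_mat of_int U *\<^sub>v v) = v"
    using U V v by (simp add: assoc_mult_mat_vec[symmetric, of _ m m _ m] 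
        of_int_hom.mat_hom_mult[symmetric, of _ m m _ m] of_int_hom.mat_hom_one)
  then show "integral_vec v" if "integral_vec (map_mat of_int U *\<^sub>v v)"
    using integral_vec_mult_mat_vec[OF that _ V(1)] U v by auto
qed (use integral_vec_mult_mat_vec U v in auto)

text \<open>Both sides say that \<open>E * D\<inverse>\<close>, which is integral by the last assumption, is unimodular.\<close>

lemma abs_det_eq_iff_onto_integral_vec:
  fixes E D :: "rat mat"
  assumes E: "E \<in> carrier_mat n n" and D: "D \<in> carrier_mat n n" and "det D \<noteq> 0"
    and DE: "\<And>x. x \<in> carrier_vec n \<Longrightarrow> integral_vec (D *\<^sub>v x) \<Longrightarrow> integral_vec (E *\<^sub>v x)"
  shows "\<bar>det E\<bar> = \<bar>det D\<bar> \<longleftrightarrow> (\<forall>y\<in>carrier_vec n. integral_vec y \<longrightarrow>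
    (\<exists>x\<in>carrier_vec n. integral_vec (D *\<^sub>v x) \<and> E *\<^sub>v x = y))" (is "_ \<longleftrightarrow> ?onto")
proof -
  have "invertible_mat D"
    using \<open>det D \<noteq> 0\<close> by (simp add: invertible_mat_iff_det_dvd_one[OF D] dvd_field_iff)
  then obtain D' where D': "D' \<in> carrier_mat n n" "D * D' = 1\<^sub>m n" "D' * D = 1\<^sub>m n"
    using invertible_matE D by metis
  have DD': "D *\<^sub>v (D' *\<^sub>v y) = y" "D' *\<^sub>v (D *\<^sub>v y) = y" if "y \<in> carrier_vec n" for y
    using that D D' by (simp_all add: assoc_mult_mat_vec[symmetric, of _ n n _ n])
  \<comment> \<open>\<open>N\<close> is to be \<open>E * D'\<close> as an integer matrix; the
    entries of that product are shown to be integral next, so the floor loses nothing.\<close>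
  define N where "N = mat n n (\<lambda>p. \<lfloor>(E * D') $$ p\<rfloor>)"
  have Nc: "N \<in> carrier_mat n n" by (simp add: N_def)
  have N: "E * D' = map_mat of_int N"
  proof (rule eq_matI)
    fix i j assume "i < dim_row (map_mat rat_of_int N)" "j < dim_col (map_mat rat_of_int N)"
    then have ij: "i < n" "j < n" by (auto simp: N_def)
    \<comment> \<open>\<open>D\<close> maps column \<open>j\<close> of \<open>D'\<close> to a unit
      vector, so \<open>DE\<close> makes column \<open>j\<close> of \<open>E * D'\<close>
      integral.\<close>
    have "integral_vec (D *\<^sub>v (D' *\<^sub>v unit_vec n j))"
      by (subst DD') (auto simp: integral_vec_iff_Ints unit_vec_def)
    then have "integral_vec (E *\<^sub>v (D' *\<^sub>v unit_vec n j))"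
      using D' by (intro DE) auto
    moreover have "(E *\<^sub>v (D' *\<^sub>v unit_vec n j)) $ i = (E * D') $$ (i, j)"
      using ij E D' by (simp add: assoc_mult_mat_vec[symmetric, of _ n n _ n] del: assoc_mult_mat_vec)
    ultimately have "(E * D') $$ (i, j) \<in> \<int>"
      using ij E D' by (auto simp: integral_vec_iff_Ints)
    then show "(E * D') $$ (i, j) = map_mat of_int N $$ (i, j)"
      using ij by (simp add: N_def of_int_floor)
  qed (use E D' in \<open>auto simp: N_def\<close>)
  \<comment> \<open>Under \<open>z = D x\<close>, the vectors \<open>x\<close> with
    \<open>D x\<close> integral correspond to all integral \<open>z\<close>, and \<open>E x\<close>
    becomes \<open>N z\<close>; the surjectivity condition is thereby one on \<open>N\<close>
    alone.\<close>
  have NE: "map_mat of_int N *\<^sub>v (D *\<^sub>v x) = E *\<^sub>v x" if "x \<in> carrier_vec n" for x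
    unfolding N[symmetric] using that E D D' DD'(2) by (simp add: assoc_mult_mat_vec[of _ n n _ n])
  have "det E * det D' = of_int (det N)" "det D * det D' = 1"
    using det_mult[OF E D'(1)] det_mult[OF D D'(1)] D' by (simp_all add: N)
  then have "det E = of_int (det N) * det D"
    by (metis mult.assoc mult.commute mult.right_neutral)
  then have "\<bar>det E\<bar> = \<bar>det D\<bar> \<longleftrightarrow> \<bar>rat_of_int (det N)\<bar> = 1"
    using \<open>det D \<noteq> 0\<close> by (simp add: abs_mult)
  also have "\<dots> \<longleftrightarrow> invertible_mat N"
    unfolding invertible_mat_iff_det_dvd_one[OF Nc] zdvd1_eq by linarith
  also have "\<dots> \<longleftrightarrow> ?onto"
  proof
    assume "invertible_mat N"
    then obtain V where V: "V \<in> carrier_mat n n" "N * V = 1\<^sub>m n"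
      using invertible_matE Nc by metis
    show ?onto
    proof (intro ballI impI)
      fix y :: "rat vec" assume y: "y \<in> carrier_vec n" "integral_vec y"
      \<comment> \<open>The preimage arises in two steps: \<open>?z\<close> solves
        \<open>N z = y\<close> and is integral because \<open>V\<close> is, then \<open>D'\<close>
        carries it back to \<open>x\<close>.\<close>
      let ?z = "map_mat of_int V *\<^sub>v y"
      have z: "?z \<in> carrier_vec n" "integral_vec ?z"
        using V y integral_vec_mult_mat_vec by auto
      have "map_mat of_int N *\<^sub>v ?z = y"
        using V Nc y by (simp add: assoc_mult_mat_vec[symmetric, of _ n n _ n]
            of_int_hom.mat_hom_mult[symmetric, of _ n n _ n] of_int_hom.mat_hom_one)
      then have "E *\<^sub>v (D' *\<^sub>v ?z) = y"
        using NE[of "D' *\<^sub>v ?z"] DD'(1)[OF z(1)] z D' by simp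
      then show "\<exists>x\<in>carrier_vec n. integral_vec (D *\<^sub>v x) \<and> E *\<^sub>v x = y"
        using DD'(1)[OF z(1)] z D' by (intro bexI[of _ "D' *\<^sub>v ?z"]) auto
    qed
  next
    assume onto: ?onto
    \<comment> \<open>Integral preimages of the unit vectors become the columns of a right inverse
      of \<open>N\<close>; taking determinants, this already makes \<open>det N\<close> a
      unit.\<close>
    have "\<exists>z\<in>carrier_vec n. N *\<^sub>v z = unit_vec n j" if "j < n" for j
    proof -
      have "integral_vec (unit_vec n j)" by (auto simp: integral_vec_iff_Ints unit_vec_def)
      then obtain x where x: "x \<in> carrier_vec n" "integral_vec (D *\<^sub>v x)" "E *\<^sub>v x = unit_vec n j"
        using onto by auto
      then obtain z where z: "D *\<^sub>v x = map_vec of_int z"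
        by (auto simp: integral_vec_def)
      then have zc: "z \<in> carrier_vec n"
        using D by (metis carrier_vec_dim_vec index_map_vec(2) mult_mat_vec_carrier x(1) carrier_vecD)
      have "map_vec rat_of_int (N *\<^sub>v z) = unit_vec n j"
        using NE[OF x(1)] x(3) unfolding z of_int_hom.mult_mat_vec_hom[OF Nc zc] by simp
      also have "\<dots> = map_vec rat_of_int (unit_vec n j)"
        by (intro eq_vecI) (auto simp: unit_vec_def)
      finally have "N *\<^sub>v z = unit_vec n j" by (rule of_int_hom.vec_hom_inj)
      then show ?thesis using zc by blast
    qed
    then obtain z where z: "\<And>j. j < n \<Longrightarrow> z j \<in> carrier_vec n \<and> N *\<^sub>v z j = unit_vec n j"
      by metis
    define V where "V = mat n n (\<lambda>(i, j). z j $ i)"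
    have Vc: "V \<in> carrier_mat n n" by (simp add: V_def)
    have "N * V = 1\<^sub>m n"
    proof (rule mat_col_eqI)
      fix j assume j: "j < dim_col (1\<^sub>m n :: int mat)"
      then have "col V j = z j"
        using z[of j] by (intro eq_vecI) (auto simp: V_def)
      then show "col (N * V) j = col (1\<^sub>m n) j"
        using j z col_mult2[OF Nc Vc] by simp
    qed (use Nc Vc in auto)
    then have "det N * det V = 1" using det_mult[OF Nc Vc] by simp
    then show "invertible_mat N"
      unfolding invertible_mat_iff_det_dvd_one[OF Nc] by (metis dvd_triv_left)
  qed
  finally show ?thesis .
qed

section \<open>Coordinates\<close>

text \<open>Links the integer scaling behind \<open>int_span\<close> with the rational one.
  Induction on \<open>k\<close> settles \<open>x = 1\<close>, and compatibility of products with
  scaling gives the rest.\<close>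

lemma of_int_mult_eq_scaleQ: "of_int k * x = of_int k *\<^sub>Q x" for x :: "'a::rat_algebra_1"
proof -
  have "(of_int k :: 'a) = of_int k *\<^sub>Q 1"
    by (induction k rule: int_induct[of _ 0])
      (simp_all add: rat_vector.scale_left_distrib rat_vector.scale_left_diff_distrib)
  then show ?thesis by (metis mult_1 mult_scaleQ_left)
qed

lemma sum_coordinate:
  assumes "is_rat_basis n w"
  shows "(\<Sum>i<n. coordinate n w x i *\<^sub>Q w i) = x"
proof -
  have "(\<Sum>v\<in>w ` {..<n}. rat_representation (w ` {..<n}) x v *\<^sub>Q v) = x"
    using assms by (intro rat_vector.sum_representation_eq) (auto simp: is_rat_basis_def)
  then show ?thesis
    using assms by (simp add: is_rat_basis_def sum.reindex coordinate_def)
qed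

lemma coordinate_linear_combination:
  assumes "is_rat_basis n w"
  shows "coordinate n w (\<Sum>j\<in>S. c j *\<^sub>Q x j) k = (\<Sum>j\<in>S. c j * coordinate n w (x j) k)"
  using assms
  by (simp add: coordinate_def is_rat_basis_def rat_vector.representation_sum
      rat_vector.representation_scale)

lemma coordinate_basis:
  assumes "is_rat_basis n w" "i < n" "k < n"
  shows "coordinate n w (w i) k = (if i = k then 1 else 0)"
  using assms
  by (auto simp: coordinate_def is_rat_basis_def rat_vector.representation_basis inj_on_eq_iff)

lemma coordinate_sum:
  assumes "is_rat_basis n w" "k < n"
  shows "coordinate n w (\<Sum>i<n. c i *\<^sub>Q w i) k = c k"
  using assms by (simp add: coordinate_linear_combination coordinate_basis if_distrib sum.delta cong: if_cong)

lemma coordinate_linear_image: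
  assumes "rat_linear f" "is_rat_basis n w" "is_rat_basis n v"
  shows "coordinate n v (f x) k = (\<Sum>i<n. coordinate n w x i * coordinate n v (f (w i)) k)"
proof -
  interpret f: Vector_Spaces.linear scaleQ scaleQ f by fact
  have "f x = (\<Sum>i<n. coordinate n w x i *\<^sub>Q f (w i))"
    by (subst sum_coordinate[OF assms(2), of x, symmetric]) (simp add: f.sum f.scale)
  then show ?thesis using assms(3) by (simp add: coordinate_linear_combination)
qed

text \<open>The order contains a rational basis, so \<open>\<gamma>\<close> spans the field over the
  rationals, and \<open>n\<close> distinct spanning vectors in dimension \<open>n\<close> are
  independent.\<close>

lemma int_basis_imp_rat_basis:
  fixes \<gamma> :: "nat \<Rightarrow> 'l::number_field"
  assumes dim: "rat_dim (UNIV :: 'l set) = n" and R: "is_int_order R" and basis: "is_int_basis n \<gamma> R"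
  shows "is_rat_basis n \<gamma>"
proof -
  let ?G = "\<gamma> ` {..<n}"
  have "int_span ?G \<subseteq> rat_span ?G"
  proof (rule int_module.span_minimal)
    show "int_module.subspace (rat_span ?G)"
      by (rule int_module.subspaceI) (simp_all add: of_int_mult_eq_scaleQ rat_vector.span_zero
          rat_vector.span_add rat_vector.span_scale)
  qed (rule rat_vector.span_superset)
  moreover obtain S where "S \<subseteq> R" "rat_span S = UNIV"
    using R by (auto simp: is_int_order_def)
  ultimately have span: "rat_span ?G = UNIV"
    using basis rat_vector.span_mono[of S "rat_span ?G"]
    by (simp add: is_int_basis_def rat_vector.span_span) blast
  obtain C where C: "C \<subseteq> ?G" "\<not> rat_dependent C" "?G \<subseteq> rat_span C"
    by (rule rat_vector.maximal_independent_subset)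
  have "rat_span C = UNIV"
    using span rat_vector.span_mono[OF C(3)] by (simp add: rat_vector.span_span top.extremum_unique)
  then have "card C = n"
    using rat_vector.dim_eq_card[of C UNIV] C(2) dim by simp
  then have "C = ?G"
    using C(1) basis by (intro card_subset_eq) (auto simp: is_int_basis_def card_image)
  then show ?thesis
    using C(2) span basis by (auto simp: is_rat_basis_def is_int_basis_def)
qed

section \<open>Coordinate vectors and the order as the integral lattice\<close>

definition coord_vec :: "nat \<Rightarrow> (nat \<Rightarrow> 'a::rat_vector) \<Rightarrow> 'a \<Rightarrow> rat vec" where
  "coord_vec n w x = vec n (coordinate n w x)"

lemma coord_vec_carrier [simp]: "coord_vec n w x \<in> carrier_vec n"
  by (simp add: coord_vec_def)

lemma coord_vec_eq_iff:
  assumes "is_rat_basis n w"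
  shows "coord_vec n w x = coord_vec n w y \<longleftrightarrow> x = y"
proof
  assume "coord_vec n w x = coord_vec n w y"
  then have "coordinate n w x i = coordinate n w y i" if "i < n" for i
    using that unfolding coord_vec_def by (metis index_vec)
  then have "(\<Sum>i<n. coordinate n w x i *\<^sub>Q w i) = (\<Sum>i<n. coordinate n w y i *\<^sub>Q w i)"
    by simp
  then show "x = y"
    by (simp only: sum_coordinate[OF assms])
qed simp

lemma coord_vec_zero: "is_rat_basis n w \<Longrightarrow> coord_vec n w 0 = 0\<^sub>v n"
  by (intro eq_vecI)
    (simp_all add: coord_vec_def coordinate_def is_rat_basis_def rat_vector.representation_zero)

lemma coord_vec_surj:
  assumes "is_rat_basis n w" "v \<in> carrier_vec n"
  obtains x where "v = coord_vec n w x"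
proof
  show "v = coord_vec n w (\<Sum>i<n. v $ i *\<^sub>Q w i)"
    using assms by (intro eq_vecI) (auto simp: coord_vec_def coordinate_sum)
qed

text \<open>Rational coordinates are unique, so an integer combination of \<open>\<gamma>\<close>
  has its integer coefficients as coordinates; conversely, integral coordinates exhibit such a
  combination.\<close>

lemma mem_iff_integral_coord_vec:
  fixes \<gamma> :: "nat \<Rightarrow> 'l::rat_algebra_1"
  assumes basis: "is_int_basis n \<gamma> R" and rat: "is_rat_basis n \<gamma>"
  shows "x \<in> R \<longleftrightarrow> integral_vec (coord_vec n \<gamma> x)"
proof
  have inj: "inj_on \<gamma> {..<n}" and span: "R = int_span (\<gamma> ` {..<n})"
    using basis by (auto simp: is_int_basis_def)
  {
    assume "x \<in> R"
    then obtain u where "x = (\<Sum>v\<in>\<gamma> ` {..<n}. of_int (u v) * v)"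
      unfolding span by (auto simp: int_module.span_finite)
    then have "x = (\<Sum>i<n. of_int (u (\<gamma> i)) *\<^sub>Q \<gamma> i)"
      by (simp add: sum.reindex[OF inj] of_int_mult_eq_scaleQ)
    then show "integral_vec (coord_vec n \<gamma> x)"
      using rat by (auto simp: integral_vec_iff_Ints coord_vec_def coordinate_sum)
  }
  assume "integral_vec (coord_vec n \<gamma> x)"
  then have "coordinate n \<gamma> x i = of_int \<lfloor>coordinate n \<gamma> x i\<rfloor>" if "i < n" for i
    using that by (simp add: integral_vec_iff_Ints coord_vec_def of_int_floor)
  then have "x = (\<Sum>i<n. of_int \<lfloor>coordinate n \<gamma> x i\<rfloor> * \<gamma> i)"
    by (subst sum_coordinate[OF rat, of x, symmetric]) (simp add: of_int_mult_eq_scaleQ)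
  also have "\<dots> \<in> R"
    unfolding span by (intro int_module.span_sum int_module.span_scale int_module.span_base) auto
  finally show "x \<in> R" .
qed

text \<open>By injectivity of the canonical map \<open>1 \<otimes> h = 0\<close>; a linear functional with value \<open>1\<close> at \<open>1\<close>,
  applied to the first factor, then gives \<open>h = 0\<close>.\<close>

lemma hopf_galois_action_faithful:
  fixes act :: "'h::rat_algebra_1 \<Rightarrow> 'l::number_field \<Rightarrow> 'l"
  assumes "hopf_galois_structure comult counit antipode act" and zero: "\<And>y. act h y = 0"
  shows "h = 0"
proof -
  interpret hopf_galois_structure comult counit antipode act by fact
  note act = rat_bilinearD[OF act_bilinear]
  have bil: "rat_bilinear (\<lambda>x h. x * act h y)" for y
    by (intro rat_bilinearI) (simp_all add: act algebra_simps mult_scaleQ_left mult_scaleQ_right)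
  \<comment> \<open>\<open>tensor_lift\<close> goes through a chosen representative, so its
    vanishing at \<open>0\<close> has to come from linearity, which bilinearity of \<open>f\<close>
    provides.\<close>
  have lift_zero: "tensor_lift f 0 = 0" if "rat_bilinear f" for f :: "'l \<Rightarrow> 'h \<Rightarrow> 'c::rat_vector"
  proof -
    interpret l: Vector_Spaces.linear scaleQ scaleQ "tensor_lift f"
      using rat_linear_tensor_lift[OF that] .
    show ?thesis by (rule l.zero)
  qed
  have "(\<lambda>y. tensor_lift (\<lambda>x h. x * act h y) (1 \<otimes>\<^sub>Q h)) = (\<lambda>y. tensor_lift (\<lambda>x h. x * act h y) 0)"
    by (simp add: tensor_lift_tens[OF bil] zero lift_zero[OF bil])
  then have tens: "(1 :: 'l) \<otimes>\<^sub>Q h = 0"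
    using canonical_bij by (auto simp: bij_betw_def dest: injD)
  \<comment> \<open>Extending \<open>{1}\<close> to a rational basis provides the functional: the
    coordinate at \<open>1\<close>.\<close>
  obtain B :: "'l set" where B: "{1} \<subseteq> B" "\<not> rat_dependent B" "UNIV \<subseteq> rat_span B"
    by (rule rat_vector.maximal_independent_subset_extend[of "{1 :: 'l}" UNIV])
      (simp_all add: rat_vector.dependent_single)
  let ?f = "\<lambda>x h :: 'h. rat_representation B x 1 *\<^sub>Q h"
  have f: "rat_bilinear ?f"
  proof -
    have span: "x \<in> rat_span B" for x using B(3) by auto
    show ?thesis
      by (intro rat_bilinearI) (simp_all add: rat_vector.representation_add[OF B(2) span span]
          rat_vector.representation_scale[OF B(2) span] scaleQ_add_left scaleQ_add_right
          scaleQ_scaleQ mult.commute)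
  qed
  have "h = ?f 1 h"
    using B by (simp add: rat_vector.representation_basis)
  also have "\<dots> = tensor_lift ?f (1 \<otimes>\<^sub>Q h)"
    by (simp add: tensor_lift_tens[OF f])
  also have "\<dots> = 0"
    unfolding tens by (rule lift_zero[OF f])
  finally show ?thesis .
qed

text \<open>\<open>U M x\<close> is \<open>D x\<close> followed by zeros, and \<open>U\<close> is
  invertible over the integers, so integrality and vanishing pass between \<open>D x\<close> and
  \<open>M x\<close>.\<close>

lemma reduced_matrix_mult_vec:
  assumes "is_reduced_matrix n M D" and M: "M \<in> carrier_mat (n\<^sup>2) n" and x: "x \<in> carrier_vec n"
  shows "integral_vec (D *\<^sub>v x) \<longleftrightarrow> integral_vec (M *\<^sub>v x)"
    and "D *\<^sub>v x = 0\<^sub>v n \<Longrightarrow> M *\<^sub>v x = 0\<^sub>v (n\<^sup>2)"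
proof -
  obtain U where D: "D \<in> carrier_mat n n" and U: "U \<in> carrier_mat (n\<^sup>2) (n\<^sup>2)" "invertible_mat U"
    and eq: "map_mat of_int U * M = D @\<^sub>r 0\<^sub>m (n\<^sup>2 - n) n"
    using assms by (auto simp: is_reduced_matrix_def)
  have nn: "n \<le> n\<^sup>2" by (simp add: power2_eq_square)
  have UMx: "map_mat of_int U *\<^sub>v (M *\<^sub>v x) = (D @\<^sub>r 0\<^sub>m (n\<^sup>2 - n) n) *\<^sub>v x"
    using U M x by (simp flip: eq)
  have Dx: "((D @\<^sub>r 0\<^sub>m (n\<^sup>2 - n) n) *\<^sub>v x) $ i = (if i < n then (D *\<^sub>v x) $ i else 0)" if "i < n\<^sup>2" for i
    using that nn D x by (simp add: append_rows_def scalar_prod_def)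
  have dim: "dim_vec ((D @\<^sub>r 0\<^sub>m (n\<^sup>2 - n) n) *\<^sub>v x) = n\<^sup>2"
    using D nn by (simp add: append_rows_def)
  have "integral_vec (M *\<^sub>v x) \<longleftrightarrow> integral_vec ((D @\<^sub>r 0\<^sub>m (n\<^sup>2 - n) n) *\<^sub>v x)"
    unfolding UMx[symmetric] using integral_vec_unimodular[OF U] M x by auto
  also have "\<dots> \<longleftrightarrow> integral_vec (D *\<^sub>v x)"
    unfolding integral_vec_iff_Ints dim using nn D by (auto simp: Dx dest: less_le_trans)
  finally show "integral_vec (D *\<^sub>v x) \<longleftrightarrow> integral_vec (M *\<^sub>v x)" ..
  assume "D *\<^sub>v x = 0\<^sub>v n"
  then have "map_mat of_int U *\<^sub>v (M *\<^sub>v x) = 0\<^sub>v (n\<^sup>2)"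
    unfolding UMx using dim by (intro eq_vecI) (auto simp: Dx simp del: index_mult_mat_vec dim_mult_mat_vec)
  moreover obtain V where V: "V \<in> carrier_mat (n\<^sup>2) (n\<^sup>2)" "V * U = 1\<^sub>m (n\<^sup>2)"
    using invertible_matE U by metis
  moreover have "map_mat rat_of_int V *\<^sub>v 0\<^sub>v (n\<^sup>2) = 0\<^sub>v (n\<^sup>2)"
    using V(1) by (intro eq_vecI) auto
  ultimately have "(map_mat of_int V * map_mat of_int U) *\<^sub>v (M *\<^sub>v x) = 0\<^sub>v (n\<^sup>2)"
    using U M x V(1) by (simp add: assoc_mult_mat_vec[of _ "n\<^sup>2" "n\<^sup>2" _ "n\<^sup>2"])
  then show "M *\<^sub>v x = 0\<^sub>v (n\<^sup>2)"
    using M x V(2) by (simp add: of_int_hom.mat_hom_mult[OF V(1) U(1), symmetric] of_int_hom.mat_hom_one)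
qed

section \<open>Free generators\<close>

locale hopf_galois_bases = hopf_galois_structure comult counit antipode act
  for comult :: "'h::rat_algebra_1 \<Rightarrow> ('h, 'h) tensor"
    and counit :: "'h \<Rightarrow> rat"
    and antipode :: "'h \<Rightarrow> 'h"
    and act :: "'h \<Rightarrow> 'l::number_field \<Rightarrow> 'l" +
  fixes n :: nat
    and R :: "'l set"
    and w :: "nat \<Rightarrow> 'h"
    and \<gamma> :: "nat \<Rightarrow> 'l"
  assumes dimension: "rat_dim (UNIV :: 'l set) = n"
    and order: "is_int_order R"
    and rat_basis_w: "is_rat_basis n w"
    and int_basis: "is_int_basis n \<gamma> R"
begin

abbreviation "M \<equiv> action_matrix n act w \<gamma>"

section \<open>The action and the associated order in coordinates\<close>

lemma act_left_linear: "rat_linear (\<lambda>h. act h y)"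
  and act_right_linear: "rat_linear (act h)"
  using act_bilinear by (auto simp: rat_bilinear_def)

lemma rat_basis: "is_rat_basis n \<gamma>"
  using int_basis_imp_rat_basis[OF dimension order int_basis] .

lemmas mem_order_iff = mem_iff_integral_coord_vec[OF int_basis rat_basis]

lemma basis_mem: "j < n \<Longrightarrow> \<gamma> j \<in> R"
  using int_basis int_module.span_base[of "\<gamma> j" "\<gamma> ` {..<n}"] by (auto simp: is_int_basis_def)

lemma action_matrix_at_mult: "action_matrix_at n act w \<gamma> j *\<^sub>v coord_vec n w h = coord_vec n \<gamma> (act h (\<gamma> j))"
  by (intro eq_vecI) (auto simp: action_matrix_at_def coord_vec_def scalar_prod_def lessThan_atLeast0
      coordinate_linear_image[OF act_left_linear rat_basis_w rat_basis, where x = h] mult.commute)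

text \<open>Linearity of \<open>act (w i)\<close> turns the weighted sum of the blocks into the
  matrix with columns the coordinates of \<open>act (w i) \<beta>\<close>; linearity in
  \<open>h\<close> then does the rest.\<close>

lemma element_matrix_mult: "element_matrix n act w \<gamma> \<beta> *\<^sub>v coord_vec n w h = coord_vec n \<gamma> (act h \<beta>)"
proof (intro eq_vecI)
  fix k assume "k < dim_vec (coord_vec n \<gamma> (act h \<beta>))"
  then have k: "k < n" by (simp add: coord_vec_def)
  have "element_matrix n act w \<gamma> \<beta> $$ (k, i) = coordinate n \<gamma> (act (w i) \<beta>) k" if "i < n" for i
    using k that by (simp add: element_matrix_def action_matrix_at_def
        coordinate_linear_image[OF act_right_linear rat_basis rat_basis, where x = \<beta>])
  then show "(element_matrix n act w \<gamma> \<beta> *\<^sub>v coord_vec n w h) $ k = coord_vec n \<gamma> (act h \<beta>) $ k"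
    using k by (auto simp: element_matrix_def coord_vec_def scalar_prod_def lessThan_atLeast0
      coordinate_linear_image[OF act_left_linear rat_basis_w rat_basis, where x = h] mult.commute intro!: sum.cong)
qed (simp add: element_matrix_def coord_vec_def)

lemma action_matrix_carrier: "M \<in> carrier_mat (n\<^sup>2) n"
  by (simp add: action_matrix_def)

lemma action_matrix_mult_index:
  assumes "j < n" "k < n"
  shows "j * n + k < n\<^sup>2" "(M *\<^sub>v coord_vec n w h) $ (j * n + k) = coordinate n \<gamma> (act h (\<gamma> j)) k"
proof -
  have "j * n + k < Suc j * n" using assms by simp
  also have "\<dots> \<le> n * n" using assms by (intro mult_right_mono) auto
  finally show less: "j * n + k < n\<^sup>2" by (simp add: power2_eq_square)
  have "(M *\<^sub>v coord_vec n w h) $ (j * n + k) = (action_matrix_at n act w \<gamma> j *\<^sub>v coord_vec n w h) $ k"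
    using assms less by (simp add: action_matrix_def scalar_prod_def action_matrix_at_def coord_vec_def)
  then show "(M *\<^sub>v coord_vec n w h) $ (j * n + k) = coordinate n \<gamma> (act h (\<gamma> j)) k"
    using assms by (simp add: action_matrix_at_mult) (simp add: coord_vec_def)
qed

text \<open>By linearity of \<open>act h\<close>, stability of the order can be tested on the
  \<open>\<gamma> j\<close>, and the coordinates of all \<open>act h (\<gamma> j)\<close> together
  are the entries of the stacked product.\<close>

lemma associated_order_iff:
  "h \<in> associated_order act R \<longleftrightarrow> integral_vec (M *\<^sub>v coord_vec n w h)"
proof -
  interpret right: Vector_Spaces.linear scaleQ scaleQ "act h" by (rule act_right_linear)
  have "h \<in> associated_order act R \<longleftrightarrow> (\<forall>j<n. act h (\<gamma> j) \<in> R)"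
  proof
    assume basis: "\<forall>j<n. act h (\<gamma> j) \<in> R"
    {
      fix x assume "x \<in> R"
      then have int: "\<forall>k<n. coordinate n \<gamma> x k \<in> \<int>"
        by (simp add: mem_order_iff integral_vec_iff_Ints coord_vec_def)
      have "act h x \<in> R"
        using int basis
        unfolding mem_order_iff integral_vec_iff_Ints coord_vec_def
          coordinate_linear_image[OF act_right_linear rat_basis rat_basis, where x = x]
        by (auto intro!: Ints_sum Ints_mult)
    }
    then show "h \<in> associated_order act R" by (simp add: associated_order_def)
  qed (auto simp: associated_order_def basis_mem)
  also have "\<dots> \<longleftrightarrow> (\<forall>j<n. \<forall>k<n. coordinate n \<gamma> (act h (\<gamma> j)) k \<in> \<int>)"
    by (simp add: mem_order_iff integral_vec_iff_Ints coord_vec_def)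
  also have "\<dots> \<longleftrightarrow> (\<forall>j<n. \<forall>k<n. (M *\<^sub>v coord_vec n w h) $ (j * n + k) \<in> \<int>)"
    by (simp add: action_matrix_mult_index)
  also have "\<dots> \<longleftrightarrow> (\<forall>r<n\<^sup>2. (M *\<^sub>v coord_vec n w h) $ r \<in> \<int>)"
  proof
    assume blocks: "\<forall>j<n. \<forall>k<n. (M *\<^sub>v coord_vec n w h) $ (j * n + k) \<in> \<int>"
    show "\<forall>r<n\<^sup>2. (M *\<^sub>v coord_vec n w h) $ r \<in> \<int>"
    proof (intro allI impI)
      fix r assume "r < n\<^sup>2"
      \<comment> \<open>Every row index has the form \<open>j * n + k\<close>; here
        \<open>r < n\<^sup>2\<close> excludes \<open>n = 0\<close>, so the remainder is below
        \<open>n\<close>.\<close>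
      then have "r div n < n" "r mod n < n"
        by (auto simp: power2_eq_square less_mult_imp_div_less intro!: mod_less_divisor gr0I)
      then show "(M *\<^sub>v coord_vec n w h) $ r \<in> \<int>"
        using blocks by (metis div_mult_mod_eq)
    qed
  next
    assume rows: "\<forall>r<n\<^sup>2. (M *\<^sub>v coord_vec n w h) $ r \<in> \<int>"
    show "\<forall>j<n. \<forall>k<n. (M *\<^sub>v coord_vec n w h) $ (j * n + k) \<in> \<int>"
      by (intro allI impI rows[rule_format] action_matrix_mult_index(1))
  qed
  finally show ?thesis
    using action_matrix_carrier by (simp add: integral_vec_iff_Ints)
qed

section \<open>Nonsingularity of reduced matrices and the index\<close>

lemma act_eq_zero_imp_zero:
  assumes "\<And>j. j < n \<Longrightarrow> act h (\<gamma> j) = 0"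
  shows "h = 0"
proof (rule hopf_galois_action_faithful[OF hopf_galois_structure_axioms])
  fix y
  interpret right: Vector_Spaces.linear scaleQ scaleQ "act h" by (rule act_right_linear)
  show "act h y = 0"
    by (subst sum_coordinate[OF rat_basis, of y, symmetric]) (simp add: right.sum right.scale assms)
qed

text \<open>A kernel vector of \<open>D\<close> is the coordinate vector of some \<open>h\<close>,
  and \<open>M\<close> kills it too. Such an \<open>h\<close> annihilates every
  \<open>\<gamma> j\<close>, hence is \<open>0\<close> by faithfulness.\<close>

lemma reduced_matrix_det_nonzero:
  assumes D: "is_reduced_matrix n M D"
  shows "det D \<noteq> 0"
proof
  assume "det D = 0"
  moreover have "D \<in> carrier_mat n n" using D by (simp add: is_reduced_matrix_def)
  ultimately obtain v where v: "v \<in> carrier_vec n" "v \<noteq> 0\<^sub>v n" "D *\<^sub>v v = 0\<^sub>v n"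
    using det_0_iff_vec_prod_zero_field by blast
  obtain h where h: "v = coord_vec n w h"
    using coord_vec_surj[OF rat_basis_w v(1)] .
  have Mv: "M *\<^sub>v coord_vec n w h = 0\<^sub>v (n\<^sup>2)"
    using reduced_matrix_mult_vec(2)[OF D action_matrix_carrier v(1) v(3)] h by simp
  have "act h (\<gamma> j) = 0" if "j < n" for j
  proof -
    have "coord_vec n \<gamma> (act h (\<gamma> j)) = coord_vec n \<gamma> 0"
      unfolding coord_vec_zero[OF rat_basis]
    proof (intro eq_vecI)
      fix k assume "k < dim_vec (0\<^sub>v n)"
      then have "k < n" by simp
      then show "coord_vec n \<gamma> (act h (\<gamma> j)) $ k = 0\<^sub>v n $ k"
        using action_matrix_mult_index(1)[OF that \<open>k < n\<close>]
          action_matrix_mult_index(2)[OF that \<open>k < n\<close>, of h] by (simp add: Mv) (simp add: coord_vec_def)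
    qed (simp add: coord_vec_def)
    then show ?thesis by (simp add: coord_vec_eq_iff[OF rat_basis])
  qed
  then have "h = 0" by (rule act_eq_zero_imp_zero)
  then show False using v h coord_vec_zero[OF rat_basis_w] by simp
qed

text \<open>Both matrices define the same lattice, the \<open>x\<close> with \<open>M x\<close>
  integral. Hence \<open>E\<close> maps the lattice of \<open>D\<close> onto the integral vectors,
  and the determinant criterion applies to the pair.\<close>

lemma reduced_matrix_abs_det_unique:
  assumes D: "is_reduced_matrix n M D" and E: "is_reduced_matrix n M E"
  shows "\<bar>det E\<bar> = \<bar>det D\<bar>"
proof -
  have c: "D \<in> carrier_mat n n" "E \<in> carrier_mat n n"
    using D E by (simp_all add: is_reduced_matrix_def)
  have iff: "integral_vec (D *\<^sub>v x) \<longleftrightarrow> integral_vec (E *\<^sub>v x)" if "x \<in> carrier_vec n" for x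
    using reduced_matrix_mult_vec(1)[OF _ action_matrix_carrier that] D E by blast
  have "invertible_mat E"
    using reduced_matrix_det_nonzero[OF E] by (simp add: invertible_mat_iff_det_dvd_one[OF c(2)] dvd_field_iff)
  then obtain E' where E': "E' \<in> carrier_mat n n" "E * E' = 1\<^sub>m n"
    using invertible_matE c(2) by metis
  have EE': "E *\<^sub>v (E' *\<^sub>v y) = y" if "y \<in> carrier_vec n" for y
    using that c E' by (simp add: assoc_mult_mat_vec[symmetric, of _ n n _ n])
  have "\<exists>x\<in>carrier_vec n. integral_vec (D *\<^sub>v x) \<and> E *\<^sub>v x = y"
    if y: "y \<in> carrier_vec n" "integral_vec y" for y
    by (intro bexI[of _ "E' *\<^sub>v y"]) (use y E' EE'[OF y(1)] iff[of "E' *\<^sub>v y"] in auto)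
  then show ?thesis
    using abs_det_eq_iff_onto_integral_vec[OF c(2,1) reduced_matrix_det_nonzero[OF D]] iff by blast
qed

text \<open>Justifies the definite description: the value is attained by \<open>D\<close> and shared
  by all reduced matrices.\<close>

lemma reduced_index_eq:
  assumes "is_reduced_matrix n M D"
  shows "reduced_index n act w \<gamma> = \<bar>det D\<bar>"
  unfolding reduced_index_def
proof (rule the_equality)
  show "\<exists>D'. is_reduced_matrix n M D' \<and> \<bar>det D\<bar> = \<bar>det D'\<bar>"
    using assms by blast
qed (use assms reduced_matrix_abs_det_unique in metis)

lemma free_generator_iff:
  assumes \<beta>: "\<beta> \<in> R"
  shows "is_free_generator act R \<beta> \<longleftrightarrow> \<bar>det (element_matrix n act w \<gamma> \<beta>)\<bar> = reduced_index n act w \<gamma>"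
proof -
  let ?E = "element_matrix n act w \<gamma> \<beta>"
  obtain D where D: "is_reduced_matrix n M D"
    using reduced_matrix_exists[OF action_matrix_carrier] .
  have Dc: "D \<in> carrier_mat n n" using D by (simp add: is_reduced_matrix_def)
  have Ec: "?E \<in> carrier_mat n n" by (simp add: element_matrix_def)
  note det_D = reduced_matrix_det_nonzero[OF D]
  have order_iff: "h \<in> associated_order act R \<longleftrightarrow> integral_vec (D *\<^sub>v coord_vec n w h)" for h
    by (simp add: associated_order_iff reduced_matrix_mult_vec(1)[OF D action_matrix_carrier])
  \<comment> \<open>This is the compatibility that the determinant criterion asks for: as
    \<open>\<beta> \<in> R\<close>, the associated order sends \<open>\<beta>\<close> into
    \<open>R\<close>.\<close>
  have stable: "integral_vec (?E *\<^sub>v x)" if x: "x \<in> carrier_vec n" "integral_vec (D *\<^sub>v x)" for x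
  proof -
    obtain h where "x = coord_vec n w h" using coord_vec_surj[OF rat_basis_w x(1)] .
    then show ?thesis
      using x(2) \<beta> order_iff mem_order_iff
      by (auto simp: element_matrix_mult associated_order_def)
  qed
  have onto_iff: "\<bar>det ?E\<bar> = \<bar>det D\<bar> \<longleftrightarrow> (\<forall>y\<in>R. \<exists>h\<in>associated_order act R. act h \<beta> = y)"
  proof (subst abs_det_eq_iff_onto_integral_vec[OF Ec Dc det_D], fact stable, intro iffI ballI impI)
    fix y assume onto: "\<forall>y\<in>carrier_vec n. integral_vec y \<longrightarrow>
      (\<exists>x\<in>carrier_vec n. integral_vec (D *\<^sub>v x) \<and> ?E *\<^sub>v x = y)" and "y \<in> R"
    then obtain x where x: "x \<in> carrier_vec n" "integral_vec (D *\<^sub>v x)" "?E *\<^sub>v x = coord_vec n \<gamma> y"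
      by (meson coord_vec_carrier mem_order_iff)
    obtain h where "x = coord_vec n w h" using coord_vec_surj[OF rat_basis_w x(1)] .
    then show "\<exists>h\<in>associated_order act R. act h \<beta> = y"
      using x by (auto simp: order_iff element_matrix_mult coord_vec_eq_iff[OF rat_basis])
  next
    fix v assume onto: "\<forall>y\<in>R. \<exists>h\<in>associated_order act R. act h \<beta> = y"
      and v: "v \<in> carrier_vec n" "integral_vec v"
    obtain y where y: "v = coord_vec n \<gamma> y" using coord_vec_surj[OF rat_basis v(1)] .
    then obtain h where "h \<in> associated_order act R" "act h \<beta> = y"
      using onto v mem_order_iff by auto
    then show "\<exists>x\<in>carrier_vec n. integral_vec (D *\<^sub>v x) \<and> ?E *\<^sub>v x = v"
      using y by (intro bexI[of _ "coord_vec n w h"]) (auto simp: order_iff element_matrix_mult)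
  qed
  \<comment> \<open>Equal determinants make \<open>?E\<close> nonsingular, so
    \<open>h \<mapsto> act h \<beta>\<close> is injective on the whole Hopf algebra; the
    independence condition thus follows from surjectivity onto \<open>R\<close>.\<close>
  have "h = 0" if "\<bar>det ?E\<bar> = \<bar>det D\<bar>" "act h \<beta> = 0" for h
  proof -
    have "?E *\<^sub>v coord_vec n w h = 0\<^sub>v n"
      using that(2) by (simp add: element_matrix_mult coord_vec_zero[OF rat_basis])
    moreover have "det ?E \<noteq> 0" using that(1) det_D by auto
    ultimately have "coord_vec n w h = 0\<^sub>v n"
      using det_0_iff_vec_prod_zero_field[OF Ec] coord_vec_carrier by blast
    then show ?thesis
      using coord_vec_eq_iff[OF rat_basis_w] coord_vec_zero[OF rat_basis_w] by metis
  qed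
  \<comment> \<open>The image lies in \<open>R\<close> because \<open>\<beta>\<close> does, so
    equality amounts to surjectivity.\<close>
  moreover have "(\<lambda>h. act h \<beta>) ` associated_order act R = R \<longleftrightarrow>
      (\<forall>y\<in>R. \<exists>h\<in>associated_order act R. act h \<beta> = y)"
    using \<beta> by (auto simp: associated_order_def) force
  ultimately show ?thesis
    using \<beta> unfolding is_free_generator_def reduced_index_eq[OF D] onto_iff[symmetric] by blast
qed

end

theorem proposition3p5:
  fixes comult :: "'h::rat_algebra_1 \<Rightarrow> ('h, 'h) tensor"
    and counit :: "'h \<Rightarrow> rat"
    and antipode :: "'h \<Rightarrow> 'h"
    and act :: "'h \<Rightarrow> 'l::number_field \<Rightarrow> 'l"
    and n :: nat
    and R :: "'l set"
    and w :: "nat \<Rightarrow> 'h"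
    and \<gamma> :: "nat \<Rightarrow> 'l"
    and b :: "nat \<Rightarrow> int"
    and \<beta> :: 'l
  assumes "rat_dim (UNIV :: 'l set) = n"
    and "hopf_galois_structure comult counit antipode act"
    and "is_int_order R"
    and "is_rat_basis n w"
    and "is_int_basis n \<gamma> R"
    and "\<beta> = (\<Sum>j<n. of_int (b j) * \<gamma> j)"
  shows "is_free_generator act R \<beta> \<longleftrightarrow>
    \<bar>det (element_matrix n act w \<gamma> \<beta>)\<bar> = reduced_index n act w \<gamma>"
proof -
  interpret hopf_galois_bases comult counit antipode act n R w \<gamma>
    using assms by (simp add: hopf_galois_bases_def hopf_galois_bases_axioms_def)
  have "\<beta> \<in> int_span (\<gamma> ` {..<n})"
    unfolding assms(6) by (intro int_module.span_sum int_module.span_scale int_module.span_base) auto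
  then show ?thesis
    using assms(5) by (intro free_generator_iff) (simp add: is_int_basis_def)
qed

end
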